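(* Let $ST$ be an oriented star of degree at least $4$. Then no digraph $H$ such that $\{H, ST\}$ is $\vec{\chi}$-finite contains the in-triangle $IT$ as a subgraph.
   Context: All digraphs are finite, loopless, and between any two distinct vertices at most one of the two possible arcs is present. A digraph is $\mathcal{F}$-free if it has no induced subdigraph isomorphic to a member of $\mathcal{F}$. The dichromatic number $\vec{\chi}(D)$ is the least $k$ such that $V(D)$ can be partitioned into $k$ sets each inducing an acyclic subdigraph. A finite family $\mathcal{F}$ is $\vec{\chi}$-finite if there is $c$ such that every $\mathcal{F}$-free digraph has dichromatic number at most $c$ (such $H$ are called heroes in $ST$-free digraphs). An oriented star of degree $t$ is an orientation of $K_{1,t}$. The in-triangle $IT$ is the digraph on vertices $a,b,c,d$ with arcs $ab, bc, ca, ad, bd, cd$. *)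

theory Defs
  imports "Graph_Theory.Graph_Theory" "HOL-Library.Disjoint_Sets"
begin

text \<open>
  Digraphs here are oriented graphs: finite, loopless, and with at most one of the two
  possible arcs between any two distinct vertices.
\<close>

locale oriented_digraph = pair_digraph +
  assumes arcs_antisym: "(u, v) \<in> parcs G \<Longrightarrow> (v, u) \<notin> parcs G"

definition acyclic_digraph :: "('a, 'b) pre_digraph \<Rightarrow> bool" where
  "acyclic_digraph D \<longleftrightarrow> (\<nexists>p. pre_digraph.cycle D p)"

text \<open>
  The parts of a partition are nonempty in the sense of \<^const>\<open>partition_on\<close>; allowing
  empty parts would not change the minimum. For a finite loopless digraph the minimum
  exists, since the partition into singletons is admissible.
\<close>

definition dichromatic_number :: "'a pair_pre_digraph \<Rightarrow> nat" where
  "dichromatic_number D =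
    (LEAST k. \<exists>P. partition_on (pverts D) P \<and> card P = k \<and>
       (\<forall>X\<in>P. acyclic_digraph (with_proj D \<restriction> X)))"

definition contains_subdigraph :: "'a pair_pre_digraph \<Rightarrow> 'b pair_pre_digraph \<Rightarrow> bool" where
  "contains_subdigraph D F \<longleftrightarrow>
    (\<exists>S. subgraph S (with_proj D) \<and> digraph_iso (with_proj F) S)"

definition contains_induced :: "'a pair_pre_digraph \<Rightarrow> 'b pair_pre_digraph \<Rightarrow> bool" where
  "contains_induced D F \<longleftrightarrow>
    (\<exists>S. induced_subgraph S (with_proj D) \<and> digraph_iso (with_proj F) S)"

definition family_free :: "'b pair_pre_digraph set \<Rightarrow> 'a pair_pre_digraph \<Rightarrow> bool" where
  "family_free \<F> D \<longleftrightarrow> (\<forall>F\<in>\<F>. \<not> contains_induced D F)"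

text \<open>
  Since one cannot quantify over types, the class of all digraphs is represented by the
  digraphs with vertices in \<^typ>\<open>nat\<close>: every finite digraph is isomorphic to one of these.
\<close>

definition dichi_finite :: "'b pair_pre_digraph set \<Rightarrow> bool" where
  "dichi_finite \<F> \<longleftrightarrow> finite \<F> \<and>
    (\<exists>c. \<forall>D :: nat pair_pre_digraph.
       oriented_digraph D \<longrightarrow> family_free \<F> D \<longrightarrow> dichromatic_number D \<le> c)"

text \<open>
  The last equation says that the underlying undirected graph is the complete bipartite
  graph between the centre \<open>x\<close> and the set \<open>L\<close> of \<open>t\<close> leaves.
\<close>

definition oriented_star :: "nat \<Rightarrow> 'a pair_pre_digraph \<Rightarrow> bool" where
  "oriented_star t S \<longleftrightarrow> oriented_digraph S \<and>
    (\<exists>x L. finite L \<and> card L = t \<and> x \<notin> L \<and> pverts S = insert x L \<and>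
       parcs S \<union> (parcs S)\<inverse> = {x} \<times> L \<union> L \<times> {x})"

text \<open>The vertices \<open>0, 1, 2, 3\<close> play the roles of \<open>a, b, c, d\<close>.\<close>

definition in_triangle :: "nat pair_pre_digraph" where
  "in_triangle = \<lparr> pverts = {0, 1, 2, 3},
     parcs = {(0, 1), (1, 2), (2, 0), (0, 3), (1, 3), (2, 3)} \<rparr>"

end

theory Submission
  imports Defs "HOL-Library.Countable"
begin

text \<open>
  Orient the rook's graph on a grid so that every row and every column is a transitive tournament.
  Cliques lie in lines, so there is no directed triangle, and three neighbours of a vertex
  never form an independent set; hence neither the in-triangle nor any star with at least three leaves occurs.
  It remains to order the lines so that every colouring with few colours has a monochromatic
  directed 4-cycle. This uses orders on a set of words such that the \<open>i\<close>-th order reverses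
  the \<open>i\<close>-th digit: every large set contains, for all \<open>i \<noteq> j\<close>, two words on which the orders
  \<open>i\<close> and \<open>j\<close> disagree. The rows of a block are indexed by \<open>p\<close> and ordered in such ways; the column
  \<open>y\<close> orders the blocks by the \<open>y\<close>-th of such orders. The pigeonhole principle applied within a block of rows gives a
  transposed pair of columns; applied to the blocks, it repeats this pair in two blocks,
  which the two columns order differently.
\<close>

section \<open>Orders with many disagreements\<close>

lemma digit_sum_less:
  fixes a :: "nat \<Rightarrow> nat"
  assumes "\<And>p. p < m \<Longrightarrow> a p < k"
  shows "(\<Sum>p<m. a p * k ^ p) < k ^ m"
  using assms
proof (induction m)
  case (Suc m)
  have "(\<Sum>p<m. a p * k ^ p) < k ^ m" using Suc by simp
  moreover have "Suc (a m) * k ^ m \<le> k * k ^ m"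
    using Suc.prems[of m] by (intro mult_right_mono) auto
  ultimately show ?case by simp
qed simp

lemma digit_sum_inj:
  fixes a b :: "nat \<Rightarrow> nat"
  assumes "\<And>p. p < m \<Longrightarrow> a p < k" "\<And>p. p < m \<Longrightarrow> b p < k"
    and "(\<Sum>p<m. a p * k ^ p) = (\<Sum>p<m. b p * k ^ p)" and "p < m"
  shows "a p = b p"
  using assms
proof (induction m arbitrary: p)
  case (Suc m)
  have la: "(\<Sum>p<m. a p * k ^ p) < k ^ m" and lb: "(\<Sum>p<m. b p * k ^ p) < k ^ m"
    using Suc.prems by (auto intro: digit_sum_less)
  have eq: "(\<Sum>p<m. a p * k ^ p) + a m * k ^ m = (\<Sum>p<m. b p * k ^ p) + b m * k ^ m"
    using Suc.prems(3) by simp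
  have "k ^ m \<noteq> 0" using la by (metis not_less_zero)
  then have "a m = ((\<Sum>p<m. a p * k ^ p) + a m * k ^ m) div k ^ m"
    using la by (subst div_mult_self1) simp_all
  also have "\<dots> = b m" unfolding eq using lb \<open>k ^ m \<noteq> 0\<close> by (subst div_mult_self1) simp_all
  finally have m: "a m = b m" .
  show ?case
  proof (cases "p = m")
    case False
    then show ?thesis using Suc.IH[of p] Suc.prems m eq by auto
  qed (simp add: m)
qed simp

text \<open>The word \<open>f\<close> is read as a number in base \<open>k\<close>, position
  \<open>0\<close> being the least significant, after digit \<open>i\<close> has been complemented.
  For \<open>i \<ge> m\<close> no digit is complemented, so every natural number indexes an
  order.\<close>

definition flip_rank :: "nat \<Rightarrow> nat \<Rightarrow> nat \<Rightarrow> (nat \<Rightarrow> nat) \<Rightarrow> nat" where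
  "flip_rank k m i f = (\<Sum>p<m. (if p = i then k - 1 - f p else f p) * k ^ p)"

lemma flip_rank_inj_on: "inj_on (flip_rank k m i) (PiE {..<m} (\<lambda>_. {..<k}))"
proof (rule inj_onI)
  fix f g assume fg: "f \<in> PiE {..<m} (\<lambda>_. {..<k})" "g \<in> PiE {..<m} (\<lambda>_. {..<k})"
    and eq: "flip_rank k m i f = flip_rank k m i g"
  have lt: "f p < k" "g p < k" if "p < m" for p
    using fg that by (auto dest: PiE_mem)
  show "f = g"
  proof (rule PiE_ext[OF fg])
    let ?flip = "\<lambda>f p. if p = i then k - 1 - f p else f p"
    fix p assume p: "p \<in> {..<m}"
    have "?flip f p < k" "?flip g p < k" if "p < m" for p
      using lt[OF that] by auto
    then have "?flip f p = ?flip g p"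
      using eq p unfolding flip_rank_def by (intro digit_sum_inj[of m "?flip f" k "?flip g" p]) blast+
    then show "f p = g p" using lt[of p] p by (auto split: if_splits)
  qed
qed

text \<open>Only the summand at position \<open>i\<close> differs between the two words, and
  complementing reverses its comparison exactly in the order with index \<open>i\<close>.\<close>

lemma flip_rank_less:
  assumes "i < m" "f i < g i" "g i < k" and eq: "\<And>p. p < m \<Longrightarrow> p \<noteq> i \<Longrightarrow> f p = g p"
  shows "j \<noteq> i \<Longrightarrow> flip_rank k m j f < flip_rank k m j g"
    and "flip_rank k m i g < flip_rank k m i f"
proof -
  have k: "0 < k ^ i" using assms(3) by (cases k) simp_all
  show "flip_rank k m j f < flip_rank k m j g" if "j \<noteq> i"
    unfolding flip_rank_def
  proof (rule sum_strict_mono_ex1)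
    have "(if p = j then k - 1 - f p else f p) \<le> (if p = j then k - 1 - g p else g p)"
      if "p < m" for p
      using eq[OF that] \<open>j \<noteq> i\<close> assms(2) by (cases "p = i") auto
    then show "\<forall>p\<in>{..<m}. (if p = j then k - 1 - f p else f p) * k ^ p
        \<le> (if p = j then k - 1 - g p else g p) * k ^ p"
      by (intro ballI mult_right_mono) auto
    show "\<exists>p\<in>{..<m}. (if p = j then k - 1 - f p else f p) * k ^ p
        < (if p = j then k - 1 - g p else g p) * k ^ p"
      using assms(1,2) that k by (intro bexI[of _ i]) auto
  qed simp
  show "flip_rank k m i g < flip_rank k m i f"
    unfolding flip_rank_def
  proof (rule sum_strict_mono_ex1)
    have "(if p = i then k - 1 - g p else g p) \<le> (if p = i then k - 1 - f p else f p)"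
      if "p < m" for p
      using eq[OF that] assms(2) by (cases "p = i") auto
    then show "\<forall>p\<in>{..<m}. (if p = i then k - 1 - g p else g p) * k ^ p
        \<le> (if p = i then k - 1 - f p else f p) * k ^ p"
      by (intro ballI mult_right_mono) auto
    have "k - 1 - g i < k - 1 - f i" using assms(2,3) by linarith
    then show "\<exists>p\<in>{..<m}. (if p = i then k - 1 - g p else g p) * k ^ p
        < (if p = i then k - 1 - f p else f p) * k ^ p"
      using assms(1) k by (intro bexI[of _ i]) simp_all
  qed simp
qed

text \<open>Pigeonhole for all coordinates at once. If every fibre failed at some coordinate
  \<open>i\<close>, deleting that coordinate would be injective on the fibre; each fibre would have
  at most \<open>k ^ (m - 1)\<close> words, and fewer than \<open>k\<close> fibres could not cover
  all \<open>k ^ m\<close> words. Hence a single \<open>v\<close> serves every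
  \<open>i\<close>.\<close>

lemma words_fibre_differing:
  fixes g :: "(nat \<Rightarrow> nat) \<Rightarrow> 'b"
  assumes W: "W = PiE {..<m} (\<lambda>_. {..<k})"
    and B: "finite B" "card B < k" and gB: "g ` W \<subseteq> B"
  shows "\<exists>v\<in>B. \<forall>i<m. \<exists>f h. f \<in> W \<and> h \<in> W \<and>
    g f = v \<and> g h = v \<and> f i < h i \<and> (\<forall>p<m. p \<noteq> i \<longrightarrow> f p = h p)"
proof (rule ccontr)
  define F where "F v = {f \<in> W. g f = v}" for v
  assume neg: "\<not> ?thesis"
  have S: "W = (\<Union>v\<in>B. F v)" using gB unfolding F_def by blast
  \<comment> \<open>The conjunct \<open>m > 0\<close> records that a failing coordinate exists; it
    makes the truncated difference \<open>m - 1\<close> harmless in the final count.\<close>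
  have bound: "m > 0 \<and> card (F v) \<le> k ^ (m - 1)" if v: "v \<in> B" for v
  proof -
    have "\<exists>i<m. \<forall>f\<in>F v. \<forall>h\<in>F v. f i < h i \<longrightarrow> \<not> (\<forall>p<m. p \<noteq> i \<longrightarrow> f p = h p)"
    proof (rule ccontr)
      assume "\<not> ?thesis"
      then have "\<forall>i<m. \<exists>f h. f \<in> W \<and> h \<in> W \<and> g f = v \<and> g h = v \<and> f i < h i \<and>
          (\<forall>p<m. p \<noteq> i \<longrightarrow> f p = h p)"
        unfolding F_def by blast
      then show False using neg v by blast
    qed
    then obtain i where i: "i < m" and no: "\<And>f h. f \<in> F v \<Longrightarrow> h \<in> F v \<Longrightarrow> f i < h i \<Longrightarrow>
        \<not> (\<forall>p<m. p \<noteq> i \<longrightarrow> f p = h p)"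
      by blast
    let ?d = "\<lambda>f. restrict f ({..<m} - {i})"
    have "inj_on ?d (F v)"
    proof (rule inj_onI)
      fix f h assume fh: "f \<in> F v" "h \<in> F v" and eq: "?d f = ?d h"
      have agree: "f p = h p" if "p < m" "p \<noteq> i" for p
        using fun_cong[OF eq, of p] that by simp
      have "f i = h i" using no[OF fh] no[OF fh(2,1)] agree
        by (metis linorder_neqE_nat)
      have "f p = h p" if "p < m" for p
        using agree[OF that] \<open>f i = h i\<close> by (cases "p = i") simp_all
      moreover have "f \<in> W" "h \<in> W" using fh by (simp_all add: F_def)
      ultimately show "f = h" unfolding W by (intro PiE_ext[of f]) auto
    qed
    moreover have "?d ` F v \<subseteq> PiE ({..<m} - {i}) (\<lambda>_. {..<k})"
      unfolding F_def W by (auto simp: PiE_iff split: if_splits)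
    moreover have "finite (PiE ({..<m} - {i}) (\<lambda>_. {..<k}))" by (intro finite_PiE) auto
    ultimately have "card (F v) \<le> card (PiE ({..<m} - {i}) (\<lambda>_. {..<k}))"
      by (meson card_inj_on_le)
    also have "\<dots> = k ^ (m - 1)" using i by (simp add: card_PiE)
    finally show ?thesis using i by auto
  qed
  have cS: "card W = k ^ m" by (simp add: W card_PiE)
  have "card W \<le> (\<Sum>v\<in>B. card (F v))" by (subst S) (rule card_UN_le[OF B(1)])
  also have "\<dots> \<le> card B * k ^ (m - 1)" using sum_bounded_above[of B "\<lambda>v. card (F v)" "k ^ (m - 1)"] bound
    by simp
  finally have le: "k ^ m \<le> card B * k ^ (m - 1)" unfolding cS .
  moreover have "k > 0" using B(2) by simp
  moreover from this have "B \<noteq> {}" using le by (auto simp: not_le)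
  then have "m > 0" using bound by blast
  then have "k ^ m = k * k ^ (m - 1)" by (simp add: power_eq_if)
  ultimately show False using B(2) by simp
qed

text \<open>The points are words over \<open>Suc b\<close> letters, one more than the number of
  colours allowed, coded as natural numbers. Two words of the fibre that differ only at position
  \<open>i\<close> are compared oppositely by order \<open>i\<close> and by every other order
  \<open>j\<close>.\<close>

lemma disagreeing_ranks:
  "\<exists>(S :: nat set) (r :: nat \<Rightarrow> nat \<Rightarrow> nat). finite S \<and> (\<forall>i. inj_on (r i) S) \<and>
    (\<forall>(g :: nat \<Rightarrow> 'b) B. finite B \<longrightarrow> card B \<le> b \<longrightarrow> g ` S \<subseteq> B \<longrightarrow>
      (\<exists>v\<in>B. \<forall>i<m. \<forall>j. i \<noteq> j \<longrightarrow>
        (\<exists>x\<in>S. \<exists>y\<in>S. g x = v \<and> g y = v \<and> r i x < r i y \<and> r j y < r j x)))"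
proof -
  define W where "W = PiE {..<m} (\<lambda>_. {..<Suc b})"
  have "finite W" unfolding W_def by (intro finite_PiE) auto
  then obtain e :: "(nat \<Rightarrow> nat) \<Rightarrow> nat" where e: "inj_on e W"
    using finite_imp_inj_to_nat_seg by metis
  define d where "d = inv_into W e"
  have d: "d (e f) = f" if "f \<in> W" for f using e that by (simp add: d_def)
  show ?thesis
  proof (intro exI[of _ "e ` W"] exI[of _ "\<lambda>i. flip_rank (Suc b) m i \<circ> d"] conjI allI impI)
    show "finite (e ` W)" using \<open>finite W\<close> by simp
    show "inj_on (flip_rank (Suc b) m i \<circ> d) (e ` W)" for i
      using flip_rank_inj_on[of "Suc b" m i] d unfolding W_def[symmetric]
      by (auto simp: inj_on_def)
    fix g :: "nat \<Rightarrow> 'b" and B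
    assume "finite B" "card B \<le> b" "g ` e ` W \<subseteq> B"
    then obtain v where v: "v \<in> B" "\<And>i. i < m \<Longrightarrow> \<exists>f h. f \<in> W \<and> h \<in> W \<and>
        g (e f) = v \<and> g (e h) = v \<and> f i < h i \<and> (\<forall>p<m. p \<noteq> i \<longrightarrow> f p = h p)"
      using words_fibre_differing[OF W_def, of B "g \<circ> e"] by (auto simp: image_comp)
    show "\<exists>v\<in>B. \<forall>i<m. \<forall>j. i \<noteq> j \<longrightarrow> (\<exists>x\<in>e ` W. \<exists>y\<in>e ` W. g x = v \<and> g y = v \<and>
        (flip_rank (Suc b) m i \<circ> d) x < (flip_rank (Suc b) m i \<circ> d) y \<and>
        (flip_rank (Suc b) m j \<circ> d) y < (flip_rank (Suc b) m j \<circ> d) x)"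
    proof (intro bexI[of _ v] allI impI)
      fix i j :: nat assume i: "i < m" "i \<noteq> j"
      obtain f h where fh: "f \<in> W" "h \<in> W" "g (e f) = v" "g (e h) = v" "f i < h i"
        "\<And>p. p < m \<Longrightarrow> p \<noteq> i \<Longrightarrow> f p = h p" using v(2)[OF i(1)] by blast
      have "h i < Suc b" using fh(2) i unfolding W_def by (auto dest: PiE_mem)
      note less = flip_rank_less[of i m f h "Suc b", OF i(1) fh(5) this fh(6)]
      show "\<exists>x\<in>e ` W. \<exists>y\<in>e ` W. g x = v \<and> g y = v \<and>
        (flip_rank (Suc b) m i \<circ> d) x < (flip_rank (Suc b) m i \<circ> d) y \<and>
        (flip_rank (Suc b) m j \<circ> d) y < (flip_rank (Suc b) m j \<circ> d) x"
        \<comment> \<open>Order \<open>i\<close> reverses digit \<open>i\<close>, so the word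
          \<open>h\<close> with the larger digit becomes the point \<open>x\<close>.\<close>
        using fh less i by (intro bexI[of _ "e h"] bexI[of _ "e f"]) (auto simp: d)
    qed (use v in auto)
  qed
qed

section \<open>Transitively oriented grids\<close>

text \<open>\<open>\<rho> a\<close> ranks the columns within row \<open>a\<close>, and
  \<open>\<kappa> b\<close> ranks the rows within column \<open>b\<close>. Every line is a
  transitive tournament once these ranks are injective.\<close>

definition grid_arcs ::
  "'r set \<Rightarrow> 'c set \<Rightarrow> ('r \<Rightarrow> 'c \<Rightarrow> nat) \<Rightarrow> ('c \<Rightarrow> 'r \<Rightarrow> nat) \<Rightarrow> ('r \<times> 'c) rel" where
  "grid_arcs A B \<rho> \<kappa> = {((a, b), (a', b')). a \<in> A \<and> a' \<in> A \<and> b \<in> B \<and> b' \<in> B \<and>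
     (a = a' \<and> \<rho> a b < \<rho> a b' \<or> b = b' \<and> \<kappa> b a < \<kappa> b a')}"

text \<open>Cells are coded by \<open>to_nat\<close> because \<open>dichi_finite\<close> ranges over
  digraphs on the natural numbers.\<close>

definition grid_digraph ::
  "'r::countable set \<Rightarrow> 'c::countable set \<Rightarrow> ('r \<Rightarrow> 'c \<Rightarrow> nat) \<Rightarrow> ('c \<Rightarrow> 'r \<Rightarrow> nat) \<Rightarrow>
    nat pair_pre_digraph" where
  "grid_digraph A B \<rho> \<kappa> =
     \<lparr> pverts = to_nat ` (A \<times> B), parcs = map_prod to_nat to_nat ` grid_arcs A B \<rho> \<kappa> \<rparr>"

lemma pverts_grid: "pverts (grid_digraph A B \<rho> \<kappa>) = to_nat ` (A \<times> B)"
  by (simp add: grid_digraph_def)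

lemma arc_grid_iff:
  "(to_nat u, to_nat v) \<in> parcs (grid_digraph A B \<rho> \<kappa>) \<longleftrightarrow> (u, v) \<in> grid_arcs A B \<rho> \<kappa>"
  by (force simp: grid_digraph_def image_iff)

lemma arc_gridE:
  assumes "(x, y) \<in> parcs (grid_digraph A B \<rho> \<kappa>)"
  obtains u v where "x = to_nat u" "y = to_nat v" "(u, v) \<in> grid_arcs A B \<rho> \<kappa>"
  using assms by (auto simp: grid_digraph_def)

lemma oriented_grid:
  assumes "finite A" "finite B"
  shows "oriented_digraph (grid_digraph A B \<rho> \<kappa>)"
proof
  have sub: "grid_arcs A B \<rho> \<kappa> \<subseteq> (A \<times> B) \<times> (A \<times> B)" by (auto simp: grid_arcs_def)
  then have "finite (grid_arcs A B \<rho> \<kappa>)" using assms by (meson finite_SigmaI finite_subset)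
  then show "finite (parcs (grid_digraph A B \<rho> \<kappa>))" by (simp add: grid_digraph_def)
  show "finite (pverts (grid_digraph A B \<rho> \<kappa>))" using assms by (simp add: pverts_grid)
  show "fst e \<in> pverts (grid_digraph A B \<rho> \<kappa>)" "snd e \<in> pverts (grid_digraph A B \<rho> \<kappa>)"
    if "e \<in> parcs (grid_digraph A B \<rho> \<kappa>)" for e
    using that sub by (auto simp: grid_digraph_def)
  show "fst e \<noteq> snd e" if "e \<in> parcs (grid_digraph A B \<rho> \<kappa>)" for e
    using that by (auto simp: grid_digraph_def grid_arcs_def)
  show "(v, u) \<notin> parcs (grid_digraph A B \<rho> \<kappa>)" if "(u, v) \<in> parcs (grid_digraph A B \<rho> \<kappa>)" for u v
    using that by (auto elim!: arc_gridE simp: arc_grid_iff) (auto simp: grid_arcs_def)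
qed

text \<open>Three pairwise adjacent cells lie in one row or one column, where the ranks would have
  to increase strictly all the way round.\<close>

lemma grid_no_directed_triangle:
  assumes "(x, y) \<in> parcs (grid_digraph A B \<rho> \<kappa>)" "(y, z) \<in> parcs (grid_digraph A B \<rho> \<kappa>)"
  shows "(z, x) \<notin> parcs (grid_digraph A B \<rho> \<kappa>)"
proof
  assume zx: "(z, x) \<in> parcs (grid_digraph A B \<rho> \<kappa>)"
  obtain u v where u: "x = to_nat u" "y = to_nat v" "(u, v) \<in> grid_arcs A B \<rho> \<kappa>"
    using assms(1) by (rule arc_gridE)
  obtain v' w where "y = to_nat v'" "z = to_nat w" "(v', w) \<in> grid_arcs A B \<rho> \<kappa>"
    using assms(2) by (rule arc_gridE)
  with u assms(2) zx have "(v, w) \<in> grid_arcs A B \<rho> \<kappa>" "(w, u) \<in> grid_arcs A B \<rho> \<kappa>"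
    by (auto simp: arc_grid_iff)
  with u(3) show False unfolding grid_arcs_def by (cases u; cases v; cases w) auto
qed

text \<open>All neighbours of a cell lie in its row or its column, so two of any three share a line,
  and injective ranks put an arc between those two.\<close>

lemma grid_claw_free:
  assumes inj: "\<And>a. a \<in> A \<Longrightarrow> inj_on (\<rho> a) B" "\<And>b. b \<in> B \<Longrightarrow> inj_on (\<kappa> b) A"
    and adj: "\<And>y. y \<in> {y1, y2, y3} \<Longrightarrow> (x, y) \<in> parcs (grid_digraph A B \<rho> \<kappa>) \<or>
      (y, x) \<in> parcs (grid_digraph A B \<rho> \<kappa>)"
    and dist: "y1 \<noteq> y2" "y1 \<noteq> y3" "y2 \<noteq> y3"
  shows "\<exists>y\<in>{y1, y2, y3}. \<exists>z\<in>{y1, y2, y3}. (y, z) \<in> parcs (grid_digraph A B \<rho> \<kappa>)"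
proof -
  define a where "a y = fst (from_nat y :: 'a \<times> 'b)" for y
  define b where "b y = snd (from_nat y :: 'a \<times> 'b)" for y
  have code: "y = to_nat (a y, b y) \<and> a y \<in> A \<and> b y \<in> B" if "y \<in> {y1, y2, y3}" for y
    using adj[OF that] by (elim disjE; elim arc_gridE) (auto simp: a_def b_def grid_arcs_def)
  have line: "a y = a x \<or> b y = b x" if "y \<in> {y1, y2, y3}" for y
    using adj[OF that] by (elim disjE; elim arc_gridE) (auto simp: a_def b_def grid_arcs_def)
  have conn: "(y, z) \<in> parcs (grid_digraph A B \<rho> \<kappa>) \<or> (z, y) \<in> parcs (grid_digraph A B \<rho> \<kappa>)"
    if yz: "y \<in> {y1, y2, y3}" "z \<in> {y1, y2, y3}" "y \<noteq> z" "a y = a z \<or> b y = b z" for y z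
  proof -
    note cy = code[OF yz(1)] and cz = code[OF yz(2)]
    have "((a y, b y), (a z, b z)) \<in> grid_arcs A B \<rho> \<kappa> \<or> ((a z, b z), (a y, b y)) \<in> grid_arcs A B \<rho> \<kappa>"
    proof (cases "a y = a z")
      case True
      then have "b y \<noteq> b z" using cy cz yz(3) by metis
      then have "\<rho> (a y) (b y) \<noteq> \<rho> (a y) (b z)" using inj(1)[of "a y"] cy cz by (auto dest: inj_onD)
      then show ?thesis using True cy cz unfolding grid_arcs_def by auto
    next
      case False
      with yz have "b y = b z" by simp
      moreover have "\<kappa> (b y) (a y) \<noteq> \<kappa> (b y) (a z)"
        using False inj(2)[of "b y"] cy cz by (auto dest: inj_onD)
      ultimately show ?thesis using cy cz unfolding grid_arcs_def by auto
    qed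
    then show ?thesis using cy cz arc_grid_iff by metis
  qed
  have "(a y1 = a y2 \<or> b y1 = b y2) \<or> (a y1 = a y3 \<or> b y1 = b y3) \<or> (a y2 = a y3 \<or> b y2 = b y3)"
    using line[of y1] line[of y2] line[of y3] by auto
  then show ?thesis using conn[of y1 y2] conn[of y1 y3] conn[of y2 y3] dist by blast
qed

section \<open>Containment and acyclic colourings\<close>

lemma contains_subdigraphE:
  assumes "contains_subdigraph D F"
  obtains h where "inj_on h (pverts F)" "\<And>u v. (u, v) \<in> parcs F \<Longrightarrow> (h u, h v) \<in> parcs D"
proof -
  from assms obtain S where S: "subgraph S (with_proj D)" "digraph_iso (with_proj F) S"
    unfolding contains_subdigraph_def by blast
  then obtain f where f: "pre_digraph.digraph_isomorphism (with_proj F) f"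
    "S = app_iso f (with_proj F)" unfolding digraph_iso_def by blast
  \<comment> \<open>Compatibility with \<open>with_proj D\<close> forces the tail and head maps of
    the image to be the projections, so its arcs are again determined by their ends.\<close>
  have t: "iso_tail f = fst" "iso_head f = snd" "iso_arcs f ` parcs F \<subseteq> parcs D"
    using S(1) f(2) unfolding subgraph_def compatible_def by auto
  show ?thesis
  proof
    show "inj_on (iso_verts f) (pverts F)"
      using f(1) unfolding pre_digraph.digraph_isomorphism_def by simp
    fix u v assume uv: "(u, v) \<in> parcs F"
    then have "iso_verts f u = fst (iso_arcs f (u, v))" "iso_verts f v = snd (iso_arcs f (u, v))"
      using f(1) t unfolding pre_digraph.digraph_isomorphism_def by force+
    then show "(iso_verts f u, iso_verts f v) \<in> parcs D" using t uv by auto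
  qed
qed

lemma contains_inducedE:
  assumes "contains_induced D F"
  obtains h where "inj_on h (pverts F)"
    "\<And>u v. u \<in> pverts F \<Longrightarrow> v \<in> pverts F \<Longrightarrow> (u, v) \<in> parcs F \<longleftrightarrow> (h u, h v) \<in> parcs D"
proof -
  from assms obtain S where S: "induced_subgraph S (with_proj D)" "digraph_iso (with_proj F) S"
    unfolding contains_induced_def by blast
  then obtain f where f: "pre_digraph.digraph_isomorphism (with_proj F) f"
    "S = app_iso f (with_proj F)" unfolding digraph_iso_def by blast
  have t: "iso_tail f = fst" "iso_head f = snd"
    "iso_arcs f ` parcs F = {e \<in> parcs D. fst e \<in> iso_verts f ` pverts F \<and> snd e \<in> iso_verts f ` pverts F}"
    using S(1) f(2) unfolding induced_subgraph_def subgraph_def compatible_def by auto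
  have inj: "inj_on (iso_verts f) (pverts F)" and "wf_digraph (with_proj F)"
    and ends: "\<And>e. e \<in> parcs F \<Longrightarrow> iso_arcs f e = (iso_verts f (fst e), iso_verts f (snd e))"
    using f(1) unfolding pre_digraph.digraph_isomorphism_def by (simp_all add: prod_eq_iff t(1,2))
  then have wf: "fst e \<in> pverts F" "snd e \<in> pverts F" if "e \<in> parcs F" for e
    using wf_digraph.wellformed[of "with_proj F" e] that by simp_all
  show ?thesis
  proof
    fix u v assume uv: "u \<in> pverts F" "v \<in> pverts F"
    show "(u, v) \<in> parcs F \<longleftrightarrow> (iso_verts f u, iso_verts f v) \<in> parcs D"
    proof
      assume uv: "(u, v) \<in> parcs F"
      then have "iso_arcs f (u, v) \<in> iso_arcs f ` parcs F" by simp
      then show "(iso_verts f u, iso_verts f v) \<in> parcs D" unfolding t(3) ends[OF uv] by simp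
    next
      assume "(iso_verts f u, iso_verts f v) \<in> parcs D"
      then have "(iso_verts f u, iso_verts f v) \<in> iso_arcs f ` parcs F" unfolding t(3) using uv by simp
      \<comment> \<open>An arc of \<open>D\<close> between image vertices is the image of some arc
        \<open>e\<close> of \<open>F\<close>; injectivity on vertices identifies the ends of
        \<open>e\<close> with \<open>u\<close> and \<open>v\<close>.\<close>
      then obtain e where e: "e \<in> parcs F" "(iso_verts f u, iso_verts f v) = iso_arcs f e" by blast
      then have "iso_verts f u = iso_verts f (fst e)" "iso_verts f v = iso_verts f (snd e)"
        using ends[OF e(1)] by simp_all
      then have "u = fst e" "v = snd e"
        using inj_on_eq_iff[OF inj] uv wf[OF e(1)] by blast+
      then show "(u, v) \<in> parcs F" using e by simp
    qed
  qed (fact inj)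
qed

text \<open>The \<open>LEAST\<close> in \<open>dichromatic_number\<close> is attained because the
  partition into singletons qualifies: a cycle inside a single vertex would use a loop.\<close>

lemma dichromatic_number_witness:
  assumes "oriented_digraph D"
  obtains P where "partition_on (pverts D) P" "card P = dichromatic_number D"
    "\<And>X. X \<in> P \<Longrightarrow> acyclic_digraph (with_proj D \<restriction> X)"
proof -
  interpret oriented_digraph D by fact
  let ?Q = "\<lambda>k. \<exists>P. partition_on (pverts D) P \<and> card P = k \<and>
       (\<forall>X\<in>P. acyclic_digraph (with_proj D \<restriction> X))"
  let ?P = "(\<lambda>v. {v}) ` pverts D"
  have acyc: "acyclic_digraph (with_proj D \<restriction> {v})" for v
    unfolding acyclic_digraph_def
  proof
    assume "\<exists>p. pre_digraph.cycle (with_proj D \<restriction> {v}) p"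
    then obtain u p where p: "p \<noteq> []" "pre_digraph.awalk (with_proj D \<restriction> {v}) u p u"
      unfolding pre_digraph.cycle_def by blast
    then have "hd p \<in> arcs (with_proj D \<restriction> {v})"
      unfolding pre_digraph.awalk_def by (meson hd_in_set subsetD)
    then show False using pair_no_loops[of "hd p"] by auto
  qed
  have "partition_on (pverts D) ?P"
    by (auto simp: partition_on_def disjoint_def)
  then have "?Q (card ?P)" using acyc by blast
  then have "?Q (dichromatic_number D)" unfolding dichromatic_number_def by (rule LeastI)
  then show ?thesis using that by blast
qed

lemma four_cycle_not_acyclic:
  assumes "distinct [a, b, c, d]" "{a, b, c, d} \<subseteq> X"
    "(a, b) \<in> parcs D" "(b, c) \<in> parcs D" "(c, d) \<in> parcs D" "(d, a) \<in> parcs D"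
  shows "\<not> acyclic_digraph (with_proj D \<restriction> X)"
  using assms unfolding acyclic_digraph_def not_not
  by (intro exI[of _ "[(a, b), (b, c), (c, d), (d, a)]"])
     (auto simp: pre_digraph.cycle_def pre_digraph.awalk_def pre_digraph.cas.simps
       pre_digraph.awalk_verts.simps)

section \<open>Grids of large dichromatic number\<close>

lemma pair_same_colour:
  assumes "finite K" "card K \<le> c" "\<And>p. p \<le> c \<Longrightarrow> f p \<in> K"
  obtains p q where "p \<le> c" "q \<le> c" "p \<noteq> q" "f p = f q"
proof -
  have "\<not> inj_on f {..c}"
  proof
    assume "inj_on f {..c}"
    then have "card {..c} \<le> card K" using assms by (intro card_inj_on_le[of f]) auto
    then show False using assms(2) by simp
  qed
  then show ?thesis using that by (auto simp: inj_on_def)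
qed

text \<open>Rows are pairs of a block \<open>x \<in> X\<close> and an index
  \<open>p \<le> c\<close>; columns are the points of \<open>Y\<close>. Applying
  \<open>disagreeing_ranks\<close> first to the columns and then to the blocks yields rows
  \<open>(x, p)\<close>, \<open>(y, q)\<close> and columns \<open>i\<close>, \<open>j\<close> whose
  four cells form the cycle.\<close>

lemma grid_monochromatic_four_cycle:
  fixes c :: nat
  obtains A :: "(nat \<times> nat) set" and B :: "nat set" and \<rho> \<kappa>
  where "finite A" "finite B" "\<And>a. inj_on (\<rho> a) B" "\<And>b. inj_on (\<kappa> b) A"
    "\<And>(col :: (nat \<times> nat) \<times> nat \<Rightarrow> 'k) K. \<lbrakk>finite K; card K \<le> c; col ` (A \<times> B) \<subseteq> K\<rbrakk> \<Longrightarrow>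
      \<exists>u1\<in>A \<times> B. \<exists>u2\<in>A \<times> B. \<exists>u3\<in>A \<times> B. \<exists>u4\<in>A \<times> B. distinct [u1, u2, u3, u4] \<and>
        col u1 = col u2 \<and> col u2 = col u3 \<and> col u3 = col u4 \<and>
        {(u1, u2), (u2, u3), (u3, u4), (u4, u1)} \<subseteq> grid_arcs A B \<rho> \<kappa>"
proof -
  \<comment> \<open>The orders \<open>r 0\<close> to \<open>r c\<close> will rank the columns. The
    bound counts triples \<open>(p, q, k)\<close>: two row indices and a colour shared by two cells
    of a column.\<close>
  obtain Y :: "nat set" and r :: "nat \<Rightarrow> nat \<Rightarrow> nat" where Y: "finite Y" "\<forall>i. inj_on (r i) Y"
    "\<forall>(g :: nat \<Rightarrow> nat \<times> nat \<times> 'k) B. finite B \<longrightarrow> card B \<le> Suc c * (Suc c * c) \<longrightarrow> g ` Y \<subseteq> B \<longrightarrow>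
      (\<exists>v\<in>B. \<forall>i<Suc c. \<forall>j. i \<noteq> j \<longrightarrow>
        (\<exists>x\<in>Y. \<exists>y\<in>Y. g x = v \<and> g y = v \<and> r i x < r i y \<and> r j y < r j x))"
    using disagreeing_ranks[where 'b = "nat \<times> nat \<times> 'k" and
        b = "Suc c * (Suc c * c)" and m = "Suc c"]
    by (elim exE conjE) (rule that)
  define n where "n = card Y"
  \<comment> \<open>The columns themselves index the block orders, so \<open>m\<close> has to exceed
    every element of \<open>Y\<close>.\<close>
  define m where "m = Suc (Max Y)"
  have Ym: "y < m" if "y \<in> Y" for y using that Y(1) by (simp add: m_def less_Suc_eq_le)
  \<comment> \<open>The bound counts the tuples \<open>(p, q, i, j, k)\<close> recording two row
    indices, two columns and a colour.\<close>
  obtain X :: "nat set" and s :: "nat \<Rightarrow> nat \<Rightarrow> nat" where X: "finite X" "\<forall>i. inj_on (s i) X"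
    "\<forall>(g :: nat \<Rightarrow> nat \<times> nat \<times> nat \<times> nat \<times> 'k) B. finite B \<longrightarrow> card B \<le> Suc c * (Suc c * (n * (n * c))) \<longrightarrow> g ` X \<subseteq> B \<longrightarrow>
      (\<exists>v\<in>B. \<forall>i<m. \<forall>j. i \<noteq> j \<longrightarrow>
        (\<exists>x\<in>X. \<exists>y\<in>X. g x = v \<and> g y = v \<and> s i x < s i y \<and> s j y < s j x))"
    using disagreeing_ranks[where 'b = "nat \<times> nat \<times> nat \<times> nat \<times> 'k" and
        b = "Suc c * (Suc c * (n * (n * c)))" and m = m]
    by (elim exE conjE) (rule that)
  define A where "A = X \<times> {..c}"
  \<comment> \<open>A row order depends on \<open>p\<close> alone; a column order compares blocks by
    \<open>s y\<close> first and breaks ties by \<open>p\<close>, a remainder modulo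
    \<open>Suc c\<close>.\<close>
  define \<rho> where "\<rho> = (\<lambda>(x :: nat, p). r p)"
  define \<kappa> where "\<kappa> = (\<lambda>y (x, p). s y x * Suc c + p)"
  have \<kappa>_less: "\<kappa> y (x, p) < \<kappa> y (x', p')" if "s y x < s y x'" "p \<le> c" for y x p x' p'
  proof -
    have "s y x * Suc c + p < Suc (s y x) * Suc c" using that by simp
    also have "\<dots> \<le> s y x' * Suc c" using that by (intro mult_right_mono) auto
    finally show ?thesis by (simp add: \<kappa>_def)
  qed
  show ?thesis
  proof
    show "finite A" "finite Y" using X(1) Y(1) by (auto simp: A_def)
    show "inj_on (\<rho> a) Y" for a using Y(2) by (cases a) (simp add: \<rho>_def)
    show "inj_on (\<kappa> y) A" for y
    proof (rule inj_onI)
      fix a a' assume a: "a \<in> A" "a' \<in> A" and eq: "\<kappa> y a = \<kappa> y a'"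
      obtain x p x' p' where xp: "a = (x, p)" "a' = (x', p')" by (cases a; cases a')
      have "\<not> s y x < s y x'" "\<not> s y x' < s y x"
        using \<kappa>_less[of y x x' p p'] \<kappa>_less[of y x' x p' p] eq a xp by (auto simp: A_def)
      then have "s y x = s y x'" by simp
      moreover from this have "p = p'" using eq xp by (simp add: \<kappa>_def)
      ultimately show "a = a'" using X(2)[rule_format, of y] a xp by (auto simp: A_def dest: inj_onD)
    qed
    fix col :: "(nat \<times> nat) \<times> nat \<Rightarrow> 'k" and K
    assume K: "finite K" "card K \<le> c" "col ` (A \<times> Y) \<subseteq> K"
    have colK: "col ((x, p), y) \<in> K" if "x \<in> X" "p \<le> c" "y \<in> Y" for x p y
      using K(3) that by (auto simp: A_def)
    \<comment> \<open>\<open>twin\<close> is what the pigeonhole principle gives in one column of a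
      block; \<open>good\<close> joins two equal twins at columns \<open>i\<close> and
      \<open>j\<close> into the pattern to be repeated in another block.\<close>
    define good where "good x t \<longleftrightarrow> (case t of (p, q, i, j, k) \<Rightarrow>
      r p i < r p j \<and> r q j < r q i \<and> col ((x, p), i) = k \<and> col ((x, p), j) = k \<and>
      col ((x, q), j) = k \<and> col ((x, q), i) = k)" for x t
    define twin where "twin x y t \<longleftrightarrow> (case t of (p, q, k) \<Rightarrow>
      p \<noteq> q \<and> col ((x, p), y) = k \<and> col ((x, q), y) = k)" for x y t
    let ?T = "{..c} \<times> {..c} \<times> Y \<times> Y \<times> K"
    have "\<exists>t\<in>?T. good x t" if x: "x \<in> X" for x
    proof -
      \<comment> \<open>Column \<open>y\<close> meets block \<open>x\<close> in \<open>Suc c\<close>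
        cells, more than there are colours.\<close>
      have "\<exists>t\<in>{..c} \<times> {..c} \<times> K. twin x y t" if y: "y \<in> Y" for y
      proof -
        obtain p q where "p \<le> c" "q \<le> c" "p \<noteq> q" "col ((x, p), y) = col ((x, q), y)"
          using pair_same_colour[of K c "\<lambda>p. col ((x, p), y)"] K colK x y by blast
        then show ?thesis using colK x y
          by (intro bexI[of _ "(p, q, col ((x, p), y))"]) (auto simp: twin_def)
      qed
      then obtain g where g: "\<And>y. y \<in> Y \<Longrightarrow> g y \<in> {..c} \<times> {..c} \<times> K"
        "\<And>y. y \<in> Y \<Longrightarrow> twin x y (g y)"
        by metis
      have "card ({..c} \<times> {..c} \<times> K) \<le> Suc c * (Suc c * c)"
        using K by (simp add: card_cartesian_product del: mult_Suc)
      then obtain v where v: "v \<in> {..c} \<times> {..c} \<times> K" "\<And>i j. i < Suc c \<Longrightarrow> i \<noteq> j \<Longrightarrow>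
        (\<exists>y\<in>Y. \<exists>z\<in>Y. g y = v \<and> g z = v \<and> r i y < r i z \<and> r j z < r j y)"
        using Y(3)[rule_format, of "{..c} \<times> {..c} \<times> K" g] K(1) g(1) by (auto simp: image_subset_iff)
      obtain p q k where pqk: "v = (p, q, k)" by (cases v)
      have "p \<noteq> q"
      proof -
        \<comment> \<open>The indices \<open>0\<close> and \<open>1\<close> merely produce some
          column in the fibre of \<open>v\<close>.\<close>
        obtain y where "y \<in> Y" "g y = v" using v(2)[of 0 1] by auto
        then show ?thesis using g(2)[of y] pqk by (simp add: twin_def)
      qed
      \<comment> \<open>As \<open>p\<close> and \<open>q\<close> index different row orders, the
        fibre contains two columns that these orders transpose.\<close>
      then obtain i j where ij: "i \<in> Y" "j \<in> Y" "g i = v" "g j = v" "r p i < r p j" "r q j < r q i"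
        using v(2)[of p q] v(1) pqk by auto
      then show ?thesis using v(1) g(2)[of i] g(2)[of j] pqk
        by (intro bexI[of _ "(p, q, i, j, k)"]) (auto simp: good_def twin_def)
    qed
    then obtain t where t: "\<And>x. x \<in> X \<Longrightarrow> t x \<in> ?T" "\<And>x. x \<in> X \<Longrightarrow> good x (t x)" by metis
    have "card ?T \<le> Suc c * (Suc c * (n * (n * c)))"
      using K by (simp add: card_cartesian_product n_def del: mult_Suc)
    then obtain v where v: "v \<in> ?T" "\<And>i j. i < m \<Longrightarrow> i \<noteq> j \<Longrightarrow>
        (\<exists>x\<in>X. \<exists>y\<in>X. t x = v \<and> t y = v \<and> s i x < s i y \<and> s j y < s j x)"
      using X(3)[rule_format, of ?T t] K(1) Y(1) t(1) by (auto simp: image_subset_iff)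
    obtain p q i j k where w: "v = (p, q, i, j, k)" by (cases v)
    have pq: "p \<le> c" "q \<le> c" and ij: "i \<in> Y" "j \<in> Y" using v(1) w by auto
    have "i \<noteq> j"
    proof -
      \<comment> \<open>Any second index, here \<open>Suc i\<close>, exhibits a block in the fibre;
        its inequality \<open>r p i < r p j\<close> separates \<open>i\<close> from
        \<open>j\<close>.\<close>
      obtain x where "x \<in> X" "t x = v" using v(2)[of i "Suc i"] Ym[OF ij(1)] by auto
      then show ?thesis using t(2)[of x] w by (auto simp: good_def)
    qed
    \<comment> \<open>The columns \<open>i\<close> and \<open>j\<close> now act as indices of block
      orders, which disagree on two blocks carrying the same pattern.\<close>
    then obtain x y where xy: "x \<in> X" "y \<in> X" "t x = v" "t y = v" "s i y < s i x" "s j x < s j y"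
      using v(2)[of i j] Ym[OF ij(1)] by blast
    have good: "good x (p, q, i, j, k)" "good y (p, q, i, j, k)" using t(2) xy w by force+
    then have "p \<noteq> q" by (auto simp: good_def)
    have less: "\<kappa> j (x, p) < \<kappa> j (y, q)" "\<kappa> i (y, q) < \<kappa> i (x, p)" using \<kappa>_less xy pq by auto
    \<comment> \<open>The arcs within rows come from \<open>good\<close> in the two blocks, those
      within columns from the opposite block orders at \<open>j\<close> and
      \<open>i\<close>.\<close>
    have arcs: "{(((x, p), i), ((x, p), j)), (((x, p), j), ((y, q), j)),
        (((y, q), j), ((y, q), i)), (((y, q), i), ((x, p), i))} \<subseteq> grid_arcs A Y \<rho> \<kappa>"
      using good less xy pq ij by (simp add: good_def grid_arcs_def A_def \<rho>_def)
    show "\<exists>u1\<in>A \<times> Y. \<exists>u2\<in>A \<times> Y. \<exists>u3\<in>A \<times> Y. \<exists>u4\<in>A \<times> Y. distinct [u1, u2, u3, u4] \<and>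
        col u1 = col u2 \<and> col u2 = col u3 \<and> col u3 = col u4 \<and>
        {(u1, u2), (u2, u3), (u3, u4), (u4, u1)} \<subseteq> grid_arcs A Y \<rho> \<kappa>"
    proof (rule bexI[of _ "((x, p), i)"], rule bexI[of _ "((x, p), j)"],
        rule bexI[of _ "((y, q), j)"], rule bexI[of _ "((y, q), i)"], intro conjI)
      show "distinct [((x, p), i), ((x, p), j), ((y, q), j), ((y, q), i)]"
        using \<open>i \<noteq> j\<close> \<open>p \<noteq> q\<close> by simp
      show "{(((x, p), i), ((x, p), j)), (((x, p), j), ((y, q), j)),
        (((y, q), j), ((y, q), i)), (((y, q), i), ((x, p), i))} \<subseteq> grid_arcs A Y \<rho> \<kappa>" by (fact arcs)
    qed (use good xy pq ij in \<open>auto simp: good_def A_def\<close>)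
  qed
qed

text \<open>An optimal partition colours each cell by the class containing its code. With at most
  \<open>c\<close> classes, a monochromatic directed 4-cycle would lie inside one acyclic
  class.\<close>

lemma grid_large_dichromatic_number:
  fixes c :: nat
  obtains A :: "(nat \<times> nat) set" and B :: "nat set" and \<rho> \<kappa>
  where "finite A" "finite B" "\<And>a. inj_on (\<rho> a) B" "\<And>b. inj_on (\<kappa> b) A"
    "c < dichromatic_number (grid_digraph A B \<rho> \<kappa>)"
proof -
  obtain A :: "(nat \<times> nat) set" and B :: "nat set" and \<rho> \<kappa> where
    G: "finite A" "finite B" "\<And>a. inj_on (\<rho> a) B" "\<And>b. inj_on (\<kappa> b) A"
    and mono: "\<And>(col :: (nat \<times> nat) \<times> nat \<Rightarrow> nat set) K. \<lbrakk>finite K; card K \<le> c; col ` (A \<times> B) \<subseteq> K\<rbrakk> \<Longrightarrow>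
      \<exists>u1\<in>A \<times> B. \<exists>u2\<in>A \<times> B. \<exists>u3\<in>A \<times> B. \<exists>u4\<in>A \<times> B. distinct [u1, u2, u3, u4] \<and>
        col u1 = col u2 \<and> col u2 = col u3 \<and> col u3 = col u4 \<and>
        {(u1, u2), (u2, u3), (u3, u4), (u4, u1)} \<subseteq> grid_arcs A B \<rho> \<kappa>"
    by (rule grid_monochromatic_four_cycle[where c = c and 'k = "nat set"]) blast
  let ?D = "grid_digraph A B \<rho> \<kappa>"
  obtain P where P: "partition_on (pverts ?D) P" "card P = dichromatic_number ?D"
    "\<And>X. X \<in> P \<Longrightarrow> acyclic_digraph (with_proj ?D \<restriction> X)"
    by (rule dichromatic_number_witness[OF oriented_grid[OF G(1,2), of \<rho> \<kappa>]]) blast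
  have "c < card P"
  proof (rule ccontr)
    assume "\<not> c < card P"
    then have "card P \<le> c" by simp
    have "finite P" using P(1) G(1,2) by (intro finite_elements[of "pverts ?D"]) (auto simp: pverts_grid)
    have "\<forall>u\<in>A \<times> B. \<exists>X. X \<in> P \<and> to_nat u \<in> X"
      using partition_onD1[OF P(1)] by (auto simp: pverts_grid)
    then obtain col where col: "\<And>u. u \<in> A \<times> B \<Longrightarrow> col u \<in> P" "\<And>u. u \<in> A \<times> B \<Longrightarrow> to_nat u \<in> col u"
      by metis
    have "col ` (A \<times> B) \<subseteq> P" using col(1) by blast
    note cycle = mono[OF \<open>finite P\<close> \<open>card P \<le> c\<close> this]
    obtain u1 u2 u3 u4 where u: "u1 \<in> A \<times> B" "u2 \<in> A \<times> B" "u3 \<in> A \<times> B" "u4 \<in> A \<times> B"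
      "distinct [u1, u2, u3, u4]" "col u1 = col u2" "col u2 = col u3" "col u3 = col u4"
      "{(u1, u2), (u2, u3), (u3, u4), (u4, u1)} \<subseteq> grid_arcs A B \<rho> \<kappa>"
      using cycle by (elim bexE conjE) (rule that)
    have "\<not> acyclic_digraph (with_proj ?D \<restriction> col u1)"
    proof (rule four_cycle_not_acyclic)
      show "distinct [to_nat u1, to_nat u2, to_nat u3, to_nat u4]" using u(5) by simp
      show "{to_nat u1, to_nat u2, to_nat u3, to_nat u4} \<subseteq> col u1" using col(2)[OF u(1)] col(2)[OF u(2)] col(2)[OF u(3)] col(2)[OF u(4)] u(6-8) by simp
    qed (use u(9) in \<open>simp_all add: arc_grid_iff\<close>)
    then show False using P(3) col(1) u(1) by blast
  qed
  then show ?thesis using that G P(2) by metis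
qed

section \<open>Grids as counterexamples to a bounded dichromatic number\<close>

theorem theorem2p4:
  fixes ST H :: "'a pair_pre_digraph" and t :: nat
  assumes "oriented_star t ST" and "t \<ge> 4"
    and "oriented_digraph H"
    and "dichi_finite {H, ST}"
  shows "\<not> contains_subdigraph H in_triangle"
proof
  assume "contains_subdigraph H in_triangle"
  then obtain h where h: "\<And>u v. (u, v) \<in> parcs in_triangle \<Longrightarrow> (h u, h v) \<in> parcs H"
    using contains_subdigraphE by metis
  \<comment> \<open>The vertices \<open>0\<close>, \<open>1\<close>, \<open>2\<close> of the
    in-triangle carry a directed triangle, which no grid contains.\<close>
  have tri: "(h 0, h 1) \<in> parcs H" "(h 1, h 2) \<in> parcs H" "(h 2, h 0) \<in> parcs H"
    by (rule h, simp add: in_triangle_def)+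
  interpret H: oriented_digraph H by fact
  obtain c where c: "\<And>D :: nat pair_pre_digraph. oriented_digraph D \<Longrightarrow> family_free {H, ST} D \<Longrightarrow>
      dichromatic_number D \<le> c"
    using assms(4) unfolding dichi_finite_def by blast
  obtain A :: "(nat \<times> nat) set" and B :: "nat set" and \<rho> \<kappa> where
    G: "finite A" "finite B" "\<And>a. inj_on (\<rho> a) B" "\<And>b. inj_on (\<kappa> b) A"
      "c < dichromatic_number (grid_digraph A B \<rho> \<kappa>)"
    by (rule grid_large_dichromatic_number[of c]) blast
  let ?D = "grid_digraph A B \<rho> \<kappa>"
  have "\<not> contains_induced ?D H"
  proof
    assume "contains_induced ?D H"
    then obtain f where f: "\<And>u v. u \<in> pverts H \<Longrightarrow> v \<in> pverts H \<Longrightarrow>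
        (u, v) \<in> parcs H \<longleftrightarrow> (f u, f v) \<in> parcs ?D"
      by (rule contains_inducedE) blast
    have "(f u, f v) \<in> parcs ?D" if "(u, v) \<in> parcs H" for u v
      using f[of u v] that H.in_arcsD1 H.in_arcsD2 by blast
    then show False using tri grid_no_directed_triangle by metis
  qed
  moreover have "\<not> contains_induced ?D ST"
  proof
    assume "contains_induced ?D ST"
    then obtain f where f: "inj_on f (pverts ST)" "\<And>u v. u \<in> pverts ST \<Longrightarrow> v \<in> pverts ST \<Longrightarrow>
        (u, v) \<in> parcs ST \<longleftrightarrow> (f u, f v) \<in> parcs ?D"
      by (rule contains_inducedE) blast
    obtain x L where L: "finite L" "card L = t" "x \<notin> L" "pverts ST = insert x L"
      "parcs ST \<union> (parcs ST)\<inverse> = {x} \<times> L \<union> L \<times> {x}"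
      using assms(1) unfolding oriented_star_def by blast
    \<comment> \<open>Three leaves and the centre of an induced star would form a claw, which
      \<open>grid_claw_free\<close> rules out.\<close>
    obtain T where "T \<subseteq> L" "card T = 3"
      using obtain_subset_with_card_n[of 3 L] L(2) assms(2) by auto
    then obtain y1 y2 y3 where y: "{y1, y2, y3} \<subseteq> L" "y1 \<noteq> y2" "y1 \<noteq> y3" "y2 \<noteq> y3"
      unfolding card_3_iff by blast
    have leaf: "(x, y) \<in> parcs ST \<or> (y, x) \<in> parcs ST" if "y \<in> L" for y
    proof -
      have "(x, y) \<in> parcs ST \<union> (parcs ST)\<inverse>" unfolding L(5) using that by simp
      then show ?thesis by simp
    qed
    have nonadj: "(y, z) \<notin> parcs ST" if "y \<in> L" "z \<in> L" for y z
    proof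
      assume "(y, z) \<in> parcs ST"
      then have "(y, z) \<in> parcs ST \<union> (parcs ST)\<inverse>" by simp
      then show False unfolding L(5) using L(3) that by auto
    qed
    have leaf': "(f x, f y) \<in> parcs ?D \<or> (f y, f x) \<in> parcs ?D" if "y \<in> L" for y
      using leaf[OF that] f(2)[of x y] f(2)[of y x] L(4) that by simp
    have "\<exists>y\<in>{f y1, f y2, f y3}. \<exists>z\<in>{f y1, f y2, f y3}. (y, z) \<in> parcs ?D"
    proof (rule grid_claw_free[where x = "f x"])
      show "(f x, z) \<in> parcs ?D \<or> (z, f x) \<in> parcs ?D" if "z \<in> {f y1, f y2, f y3}" for z
        using that leaf'[of y1] leaf'[of y2] leaf'[of y3] y(1) by auto
      show "f y1 \<noteq> f y2" "f y1 \<noteq> f y3" "f y2 \<noteq> f y3" using y L(4) by (simp_all add: inj_on_eq_iff[OF f(1)])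
    qed (use G in auto)
    then obtain y z where "y \<in> L" "z \<in> L" "(f y, f z) \<in> parcs ?D" using y(1) by blast
    then show False using nonadj f(2)[of y z] L(4) by blast
  qed
  ultimately have "family_free {H, ST} ?D" by (simp add: family_free_def)
  then have "dichromatic_number ?D \<le> c" by (rule c[OF oriented_grid[OF G(1,2)]])
  then show False using G(5) by simp
qed

end
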